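(* Let $A_c\in\mathbb{R}^{n\times n}$, $G\in\mathbb{R}^{m\times n}$, $b\in\mathbb{R}^m$, let $\mathcal{P}=\{x\in\mathbb{R}^n \mid Gx\le b\}$ be an invariant set for the continuous system $\dot{x}(t)=A_cx(t)$, and let $p\ge 1$ be an integer. Let $H\in\mathbb{R}^{m\times m}$ satisfy $H\ge_o 0$, $HG=GA_c$ and $Hb\le 0$, and let $\gamma>0$ be such that $H+\gamma I\ge 0$. For $i=0,1,\dots,p$ put $$f_i(\Delta t)=\sum_{k=i}^p\frac{(-1)^{k-i}}{k!}\binom{k}{i}\gamma^{k-i}\Delta t^k,$$ let $\tau_i\in(0,\infty]$ be the first (smallest) positive zero of $f_i$ ($\tau_i=\infty$ if there is none), and let $\tau=\min_{i=0,\dots,p}\tau_i$. Then $\tau$ is a valid steplength threshold for invariance preserving on $\mathcal{P}$ of the Taylor approximation type discretization method $x_{k+1}=\big(\sum_{i=0}^p\frac{1}{i!}A_c^i\Delta t^i\big)x_k$, and $\tau$ is the minimum of the first positive zeros ($\infty$ if there is none) of finitely many polynomials, each of the form $$f(\Delta t)=1+\alpha_1\Delta t+\alpha_2\Delta t^2+\dots+\alpha_q\Delta t^q,\qquad \alpha_q\ne 0,$$ with $\alpha_1,\dots,\alpha_q\in\mathbb{R}$ and $q\in\mathbb{N}$ (for $q=0$ this is the constant polynomial $1$).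
   Context: Matrix and vector inequalities are entrywise: $M\ge 0$ means all entries of $M$ are nonnegative; $M\ge_o 0$ means all off-diagonal entries of $M$ are nonnegative. A set $\mathcal{S}\subseteq\mathbb{R}^n$ is an invariant set for $\dot x(t)=A_cx(t)$ if $x(0)\in\mathcal{S}$ implies $x(t)\in\mathcal{S}$ for all $t\ge 0$; it is an invariant set for $x_{k+1}=A_dx_k$ if $x_k\in\mathcal{S}$ implies $x_{k+1}\in\mathcal{S}$ for all $k\in\mathbb{N}$ (equivalently $A_d\mathcal{S}\subseteq\mathcal{S}$). Let $\mathcal{P}$ be an invariant set for the continuous system and let a discretization method with steplength $\Delta t$ be applied to it, giving a discrete system. A number $\tau>0$ is a (valid) steplength threshold for invariance preserving of the method on $\mathcal{P}$ if $\mathcal{P}$ is an invariant set for the discrete system for every $\Delta t\in[0,\tau]$. Known fact used to define the data: $\mathcal{P}=\{x\mid Gx\le b\}$ is an invariant set for the continuous system if and only if there is $H\in\mathbb{R}^{m\times m}$ with $H\ge_o0$, $HG=GA_c$, $Hb\le 0$; and for such $H$ there always exists $\gamma>0$ with $H+\gamma I\ge 0$. *)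

theory Defs
  imports "HOL-Analysis.Analysis" "HOL-Computational_Algebra.Polynomial"
begin

text \<open>Both \<open>\<le>\<close> on \<open>real ^ 'm\<close> and \<open>\<le>\<close> on \<open>real ^ 'n ^ 'm\<close> are the library's entrywise orders.\<close>

definition offdiag_nonneg :: "real ^ 'm ^ 'm \<Rightarrow> bool" where
  "offdiag_nonneg M \<longleftrightarrow> (\<forall>i j. i \<noteq> j \<longrightarrow> 0 \<le> M $ i $ j)"

definition continuous_invariant :: "real ^ 'n ^ 'n \<Rightarrow> (real ^ 'n) set \<Rightarrow> bool" where
  "continuous_invariant A S \<longleftrightarrow>
     (\<forall>x. (\<forall>t\<ge>0. (x has_vector_derivative A *v x t) (at t within {0..})) \<longrightarrow>
          x 0 \<in> S \<longrightarrow> (\<forall>t\<ge>0. x t \<in> S))"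

definition discrete_invariant :: "real ^ 'n ^ 'n \<Rightarrow> (real ^ 'n) set \<Rightarrow> bool" where
  "discrete_invariant A S \<longleftrightarrow>
     (\<forall>x :: nat \<Rightarrow> real ^ 'n. (\<forall>k. x (Suc k) = A *v x k) \<longrightarrow>
          (\<forall>k. x k \<in> S \<longrightarrow> x (Suc k) \<in> S))"

text \<open>\<open>D\<close> maps a steplength to the matrix of the discrete system. A threshold may be
  \<open>\<infinity>\<close>, in which case every nonnegative steplength is admitted.\<close>

definition steplength_threshold ::
    "(real \<Rightarrow> real ^ 'n ^ 'n) \<Rightarrow> (real ^ 'n) set \<Rightarrow> ereal \<Rightarrow> bool" where
  "steplength_threshold D S \<tau> \<longleftrightarrow>
     0 < \<tau> \<and> (\<forall>\<Delta>t\<ge>0. ereal \<Delta>t \<le> \<tau> \<longrightarrow> discrete_invariant (D \<Delta>t) S)"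

text \<open>The library's \<open>*\<close>, and hence \<open>^\<close>, is componentwise on vectors and matrices,
  so powers with respect to the matrix product \<open>**\<close> need their own definition.\<close>

primrec matpow :: "real ^ 'n ^ 'n \<Rightarrow> nat \<Rightarrow> real ^ 'n ^ 'n" where
  "matpow A 0 = mat 1"
| "matpow A (Suc k) = A ** matpow A k"

definition taylor_step :: "real ^ 'n ^ 'n \<Rightarrow> nat \<Rightarrow> real \<Rightarrow> real ^ 'n ^ 'n" where
  "taylor_step A p \<Delta>t = (\<Sum>i=0..p. (1 / fact i * \<Delta>t ^ i) *\<^sub>R matpow A i)"

text \<open>For a polynomial function that is not identically zero, the positive zeros are finite in
  number, so the \<open>LEAST\<close> below exists as soon as there is a positive zero.\<close>

definition first_pos_zero :: "(real \<Rightarrow> real) \<Rightarrow> ereal" where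
  "first_pos_zero f =
     (if \<exists>t>0. f t = 0 then ereal (LEAST t. 0 < t \<and> f t = 0) else \<infinity>)"

definition taylor_coeff :: "nat \<Rightarrow> real \<Rightarrow> nat \<Rightarrow> real \<Rightarrow> real" where
  "taylor_coeff p \<gamma> i \<Delta>t =
     (\<Sum>k=i..p. (-1) ^ (k - i) / fact k * real (k choose i) * \<gamma> ^ (k - i) * \<Delta>t ^ k)"

definition taylor_threshold :: "nat \<Rightarrow> real \<Rightarrow> ereal" where
  "taylor_threshold p \<gamma> = Min ((\<lambda>i. first_pos_zero (taylor_coeff p \<gamma> i)) ` {0..p})"

text \<open>Polynomials \<open>1 + \<alpha>\<^sub>1 t + \<dots> + \<alpha>\<^sub>q t\<^sup>q\<close> with \<open>\<alpha>\<^sub>q \<noteq> 0\<close>;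
  for \<open>q = 0\<close> the constant polynomial \<open>1\<close>.\<close>

definition unit_constant_form :: "real poly \<Rightarrow> bool" where
  "unit_constant_form f \<longleftrightarrow>
     (\<exists>(q::nat) \<alpha>. (q \<ge> 1 \<longrightarrow> \<alpha> q \<noteq> 0) \<and> f = 1 + (\<Sum>k=1..q. monom (\<alpha> k) k))"

end

theory Submission
  imports Defs
begin

text \<open>Put \<open>M = H + \<gamma> I\<close>, a nonnegative matrix. Expanding \<open>H\<^sup>k = (M - \<gamma> I)\<^sup>k\<close> by the binomial
  theorem turns the Taylor sum of \<open>H\<close> into \<open>\<Sum>i\<le>p. f\<^sub>i(t) M\<^sup>i\<close>, where \<open>f\<^sub>i\<close> is
  \<open>taylor_coeff p \<gamma> i\<close>. Moreover \<open>f\<^sub>i(t) = (t\<^sup>i / i!) \<cdot> g(t)\<close> with \<open>g\<close> the Taylor polynomial of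
  \<open>exp (-\<gamma> t)\<close> of degree \<open>p - i\<close>. As \<open>g(0) = 1\<close>, the positive zeros of \<open>f\<^sub>i\<close> are those of a polynomial
  with constant term \<open>1\<close>, and \<open>f\<^sub>i \<ge> 0\<close> up to the first of them, by the intermediate value
  theorem.

  Let \<open>0 \<le> t \<le> \<tau>\<close> and \<open>G x \<le> b\<close>. From \<open>G A = H G\<close>, the image \<open>y\<close> of \<open>x\<close> under the Taylor step
  satisfies \<open>G y = (\<Sum>i\<le>p. f\<^sub>i(t) M\<^sup>i) (G x)\<close>, which is at most \<open>\<Sum>i\<le>p. f\<^sub>i(t) M\<^sup>i b\<close> because all \<open>f\<^sub>i(t)\<close>
  and all \<open>M\<^sup>i\<close> are nonnegative. The condition \<open>H b \<le> 0\<close> says \<open>M b \<le> \<gamma> b\<close>, hence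
  \<open>M\<^sup>i b \<le> \<gamma>\<^sup>i b\<close>, and \<open>\<Sum>i\<le>p. f\<^sub>i(t) \<gamma>\<^sup>i = 1\<close> is the same binomial expansion for the
  scalar \<open>0 = \<gamma> - \<gamma>\<close>. So \<open>G y \<le> b\<close>.\<close>

section \<open>Truncated exponentials and first positive zeros\<close>

text \<open>The Taylor polynomial of degree \<open>n\<close> of \<open>t \<mapsto> exp (- \<gamma> * t)\<close> at \<open>0\<close>.\<close>

definition trunc_exp :: "real \<Rightarrow> nat \<Rightarrow> real poly" where
  "trunc_exp \<gamma> n = (\<Sum>j\<le>n. monom ((-\<gamma>) ^ j / fact j) j)"

lemma poly_trunc_exp: "poly (trunc_exp \<gamma> n) t = (\<Sum>j\<le>n. (-\<gamma>) ^ j / fact j * t ^ j)"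
  by (simp add: trunc_exp_def poly_sum poly_monom)

lemma poly_trunc_exp_0: "poly (trunc_exp \<gamma> n) 0 = 1"
  by (simp add: poly_trunc_exp sum.atMost_shift)

lemma trunc_exp_nonzero: "trunc_exp \<gamma> n \<noteq> 0"
  using poly_trunc_exp_0[of \<gamma> n] by auto

lemma unit_constant_form_trunc_exp:
  assumes "\<gamma> \<noteq> 0"
  shows "unit_constant_form (trunc_exp \<gamma> n)"
proof -
  have "trunc_exp \<gamma> n = 1 + (\<Sum>k=1..n. monom ((-\<gamma>) ^ k / fact k) k)"
    by (simp add: trunc_exp_def atMost_atLeast0 sum.atLeast_Suc_atMost monom_0 one_pCons)
  moreover have "(-\<gamma>) ^ n / fact n \<noteq> 0"
    using assms by simp
  ultimately show ?thesis
    unfolding unit_constant_form_def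
    by (intro exI[of _ n] exI[of _ "\<lambda>k. (-\<gamma>) ^ k / fact k"]) blast
qed

lemma taylor_coeff_eq_trunc_exp:
  assumes "i \<le> p"
  shows "taylor_coeff p \<gamma> i t = t ^ i / fact i * poly (trunc_exp \<gamma> (p - i)) t"
proof -
  have "taylor_coeff p \<gamma> i t =
      (\<Sum>j=0..p - i. (-1) ^ j / fact (j + i) * real ((j + i) choose i) * \<gamma> ^ j * t ^ (j + i))"
    unfolding taylor_coeff_def
    using sum.shift_bounds_cl_nat_ivl[of "\<lambda>k. (-1) ^ (k - i) / fact k * real (k choose i) * \<gamma> ^ (k - i) * t ^ k" 0 i "p - i"]
      assms by simp
  also have "\<dots> = (\<Sum>j=0..p - i. t ^ i / fact i * ((-\<gamma>) ^ j / fact j * t ^ j))"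
  proof (rule sum.cong[OF refl])
    fix j
    have "real ((j + i) choose i) = fact (j + i) / (fact i * fact j)"
      by (simp add: binomial_fact)
    then show "(-1) ^ j / fact (j + i) * real ((j + i) choose i) * \<gamma> ^ j * t ^ (j + i)
        = t ^ i / fact i * ((-\<gamma>) ^ j / fact j * t ^ j)"
      by (simp add: power_add power_minus[of \<gamma>] field_simps)
  qed
  finally show ?thesis
    by (simp add: poly_trunc_exp sum_distrib_left atMost_atLeast0)
qed

lemma first_pos_zero_taylor_coeff:
  assumes "i \<le> p"
  shows "first_pos_zero (taylor_coeff p \<gamma> i) = first_pos_zero (poly (trunc_exp \<gamma> (p - i)))"
proof -
  have "0 < t \<and> taylor_coeff p \<gamma> i t = 0 \<longleftrightarrow> 0 < t \<and> poly (trunc_exp \<gamma> (p - i)) t = 0" for t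
    using taylor_coeff_eq_trunc_exp[OF assms] by auto
  then show ?thesis
    by (simp add: first_pos_zero_def)
qed

lemma least_pos_zero_poly:
  fixes q :: "real poly"
  assumes "q \<noteq> 0" "s > 0" "poly q s = 0"
  obtains z where "first_pos_zero (poly q) = ereal z" "0 < z" "z \<le> s"
proof -
  define Z where "Z = {t. 0 < t \<and> poly q t = 0}"
  have "finite Z"
    using poly_roots_finite[OF assms(1)] by (rule rev_finite_subset) (auto simp: Z_def)
  moreover have "s \<in> Z"
    using assms by (simp add: Z_def)
  ultimately have min: "Min Z \<in> Z" "\<And>t. t \<in> Z \<Longrightarrow> Min Z \<le> t"
    by (auto intro: Min_in)
  have "(LEAST t. 0 < t \<and> poly q t = 0) = Min Z"
    by (rule Least_equality) (use min in \<open>auto simp: Z_def\<close>)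
  then have "first_pos_zero (poly q) = ereal (Min Z)"
    using assms(2,3) by (auto simp: first_pos_zero_def)
  then show thesis
    using that[of "Min Z"] min \<open>s \<in> Z\<close> by (auto simp: Z_def)
qed

lemma first_pos_zero_poly_pos:
  fixes q :: "real poly"
  assumes "q \<noteq> 0"
  shows "0 < first_pos_zero (poly q)"
proof (cases "\<exists>t>0. poly q t = 0")
  case True
  then show ?thesis
    using least_pos_zero_poly[OF assms] by (metis ereal_less(2))
next
  case False
  then show ?thesis
    unfolding first_pos_zero_def by (subst if_not_P) simp_all
qed

lemma poly_nonneg_before_first_pos_zero:
  fixes q :: "real poly"
  assumes "poly q 0 > 0" "0 \<le> t" "ereal t \<le> first_pos_zero (poly q)"
  shows "0 \<le> poly q t"
proof (rule ccontr)
  assume "\<not> 0 \<le> poly q t"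
  then have neg: "poly q t < 0" by simp
  with assms(1,2) have "0 < t"
    by (metis less_le not_less_iff_gr_or_eq)
  from poly_IVT_neg[OF this assms(1) neg] obtain s where s: "0 < s" "s < t" "poly q s = 0"
    by blast
  have "q \<noteq> 0" using assms(1) by auto
  from least_pos_zero_poly[OF this s(1,3)] obtain z where "first_pos_zero (poly q) = ereal z" "z \<le> s"
    by blast
  with s(2) assms(3) show False by simp
qed

section \<open>Binomial rearrangement of the Taylor sum\<close>

lemma matrix_add_rdistrib:
  fixes A B :: "'a::semiring_1 ^ 'n ^ 'm"
  shows "(A + B) ** C = A ** C + B ** C"
  by (simp add: matrix_matrix_mult_def vec_eq_iff distrib_right sum.distrib)

lemma matpow_add_scalar:
  fixes M :: "real ^ 'n ^ 'n"
  shows "matpow (M + c *\<^sub>R mat 1) k = (\<Sum>i\<le>k. (real (k choose i) * c ^ (k - i)) *\<^sub>R matpow M i)"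
proof (induction k)
  case 0
  then show ?case by simp
next
  case (Suc k)
  define a where "a k i = real (k choose i) * c ^ (k - i)" for k i
  \<comment> \<open>Pascal's rule; it holds for all \<open>i\<close> since \<open>a k i = 0\<close> for \<open>i > k\<close>.\<close>
  have pascal: "a (Suc k) (Suc i) = a k i + c * a k (Suc i)" for i
  proof (cases "Suc i \<le> k")
    case True
    then have "k - i = Suc (k - Suc i)" by simp
    then show ?thesis by (simp add: a_def algebra_simps)
  next
    case False
    then show ?thesis by (simp add: a_def)
  qed
  have mult_sum: "M ** (\<Sum>i\<in>I. a k i *\<^sub>R matpow M i) = (\<Sum>i\<in>I. a k i *\<^sub>R matpow M (Suc i))"
    for I
    by (induction I rule: infinite_finite_induct)
       (simp_all add: matrix_add_ldistrib matrix_scalar_ac scalar_matrix_assoc)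
  have "matpow (M + c *\<^sub>R mat 1) (Suc k) = (M + c *\<^sub>R mat 1) ** (\<Sum>i\<le>k. a k i *\<^sub>R matpow M i)"
    using Suc by (simp add: a_def)
  also have "\<dots> = M ** (\<Sum>i\<le>k. a k i *\<^sub>R matpow M i) + c *\<^sub>R (\<Sum>i\<le>k. a k i *\<^sub>R matpow M i)"
    by (simp add: matrix_add_rdistrib scalar_matrix_assoc[symmetric])
  also have "\<dots> = (\<Sum>i\<le>k. a k i *\<^sub>R matpow M (Suc i)) + c *\<^sub>R (\<Sum>i\<le>Suc k. a k i *\<^sub>R matpow M i)"
    unfolding mult_sum by (simp add: a_def)
  also have "\<dots> = (\<Sum>i\<le>Suc k. a (Suc k) i *\<^sub>R matpow M i)"
    unfolding sum.atMost_Suc_shift pascal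
    by (simp add: scaleR_add_left scaleR_add_right sum.distrib scaleR_sum_right)
       (simp add: a_def)
  finally show ?case
    by (simp add: a_def)
qed

text \<open>Interchange of summation; it will be used for \<open>v i = M\<^sup>i\<close> and for \<open>v i = \<gamma>\<^sup>i\<close>.\<close>

lemma sum_taylor_coeff:
  fixes v :: "nat \<Rightarrow> 'v::real_vector"
  shows "(\<Sum>i\<le>p. taylor_coeff p \<gamma> i t *\<^sub>R v i) =
    (\<Sum>k\<le>p. (1 / fact k * t ^ k) *\<^sub>R (\<Sum>i\<le>k. (real (k choose i) * (-\<gamma>) ^ (k - i)) *\<^sub>R v i))"
proof -
  define w where "w k i = (1 / fact k * t ^ k * (real (k choose i) * (-\<gamma>) ^ (k - i))) *\<^sub>R v i" for k i
  have w0: "w k i = 0" if "k < i" for k i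
    using that by (simp add: w_def)
  have "(\<Sum>i\<le>p. taylor_coeff p \<gamma> i t *\<^sub>R v i) = (\<Sum>i\<le>p. \<Sum>k=i..p. w k i)"
    unfolding taylor_coeff_def w_def scaleR_sum_left
    by (intro sum.cong refl arg_cong2[where f = scaleR])
       (simp add: power_minus[of \<gamma>])
  also have "\<dots> = (\<Sum>i\<le>p. \<Sum>k\<le>p. w k i)"
    by (intro sum.cong refl sum.mono_neutral_left) (auto intro: w0)
  also have "\<dots> = (\<Sum>k\<le>p. \<Sum>i\<le>p. w k i)"
    by (rule sum.swap)
  also have "\<dots> = (\<Sum>k\<le>p. \<Sum>i\<le>k. w k i)"
    by (intro sum.cong refl sum.mono_neutral_right) (auto intro: w0)
  finally show ?thesis
    by (simp add: w_def scaleR_sum_right)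
qed

lemma taylor_step_eq_sum_taylor_coeff:
  "taylor_step H p t = (\<Sum>i\<le>p. taylor_coeff p \<gamma> i t *\<^sub>R matpow (H + \<gamma> *\<^sub>R mat 1) i)"
  using matpow_add_scalar[of "H + \<gamma> *\<^sub>R mat 1" "-\<gamma>"]
  by (simp add: sum_taylor_coeff taylor_step_def atLeast0AtMost)

lemma sum_taylor_coeff_power: "(\<Sum>i\<le>p. taylor_coeff p \<gamma> i t * \<gamma> ^ i) = 1"
proof -
  have "(\<Sum>i\<le>k. real (k choose i) * (-\<gamma>) ^ (k - i) * \<gamma> ^ i) = 0 ^ k" for k
    using binomial_ring[of \<gamma> "-\<gamma>" k] by (simp add: mult_ac)
  then have "(\<Sum>i\<le>p. taylor_coeff p \<gamma> i t * \<gamma> ^ i) = (\<Sum>k\<le>p. 1 / fact k * t ^ k * 0 ^ k)"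
    using sum_taylor_coeff[of p \<gamma> t "\<lambda>i. \<gamma> ^ i"] by simp
  also have "\<dots> = 1"
    by (simp add: sum.atMost_shift)
  finally show ?thesis .
qed

section \<open>Nonnegative matrices and invariance\<close>

lemma matrix_vector_mult_mono:
  fixes M :: "real ^ 'n ^ 'm"
  assumes "0 \<le> M" "x \<le> y"
  shows "M *v x \<le> M *v y"
  using assms unfolding less_eq_vec_def
  by (auto simp: matrix_vector_mult_def intro!: sum_mono mult_left_mono)

lemma matpow_mult_vector_mono:
  fixes M :: "real ^ 'n ^ 'n"
  assumes "0 \<le> M" "x \<le> y"
  shows "matpow M i *v x \<le> matpow M i *v y"
proof (induction i)
  case 0
  then show ?case using assms by simp
next
  case (Suc i)
  then show ?case
    using matrix_vector_mult_mono[OF assms(1) Suc]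
    by (simp add: matrix_vector_mul_assoc)
qed

lemma matpow_mult_vector_le:
  fixes M :: "real ^ 'n ^ 'n"
  assumes "0 \<le> M" "M *v b \<le> \<gamma> *\<^sub>R b" "0 \<le> \<gamma>"
  shows "matpow M i *v b \<le> \<gamma> ^ i *\<^sub>R b"
proof (induction i)
  case 0
  then show ?case by simp
next
  case (Suc i)
  have "matpow M (Suc i) *v b = M *v (matpow M i *v b)"
    by (simp add: matrix_vector_mul_assoc)
  also have "\<dots> \<le> M *v (\<gamma> ^ i *\<^sub>R b)"
    by (rule matrix_vector_mult_mono[OF assms(1) Suc])
  also have "\<dots> = \<gamma> ^ i *\<^sub>R (M *v b)"
    by (simp add: matrix_vector_mult_scaleR)
  also have "\<dots> \<le> \<gamma> ^ i *\<^sub>R (\<gamma> *\<^sub>R b)"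
    using assms(2,3) by (intro scaleR_left_mono) simp_all
  finally show ?case
    by (simp add: mult_ac)
qed

lemma sum_scaleR_mult_vector:
  fixes B :: "'i \<Rightarrow> real ^ 'n ^ 'm"
  shows "(\<Sum>i\<in>I. c i *\<^sub>R B i) *v x = (\<Sum>i\<in>I. c i *\<^sub>R (B i *v x))"
  by (induction I rule: infinite_finite_induct)
     (simp_all add: matrix_vector_mult_add_rdistrib scaleR_matrix_vector_assoc)

lemma matpow_intertwine:
  fixes G :: "real ^ 'n ^ 'm"
  assumes "H ** G = G ** A"
  shows "G *v (matpow A i *v x) = matpow H i *v (G *v x)"
proof (induction i)
  case 0
  then show ?case by simp
next
  case (Suc i)
  have "G *v (matpow A (Suc i) *v x) = (G ** A) *v (matpow A i *v x)"
    by (simp add: matrix_vector_mul_assoc matrix_mul_assoc)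
  also have "\<dots> = H *v (G *v (matpow A i *v x))"
    by (simp add: assms[symmetric] matrix_vector_mul_assoc matrix_mul_assoc)
  finally show ?case
    unfolding Suc by (simp add: matrix_vector_mul_assoc matrix_mul_assoc)
qed

lemma taylor_step_intertwine:
  fixes G :: "real ^ 'n ^ 'm"
  assumes "H ** G = G ** A"
  shows "G *v (taylor_step A p t *v x) = taylor_step H p t *v (G *v x)"
proof -
  have "linear ((*v) G)" by simp
  then show ?thesis
    by (simp add: taylor_step_def sum_scaleR_mult_vector linear_sum linear_scale
        matpow_intertwine[OF assms])
qed

text \<open>The invariance criterion for a single steplength: nonnegativity of the coefficients
  \<open>taylor_coeff p \<gamma> i t\<close> suffices.\<close>

lemma taylor_step_preserves_polyhedron:
  fixes A :: "real ^ 'n ^ 'n" and G :: "real ^ 'n ^ 'm" and H :: "real ^ 'm ^ 'm"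
  assumes HG: "H ** G = G ** A" and Hb: "H *v b \<le> 0"
    and \<gamma>: "0 \<le> \<gamma>" and M: "0 \<le> H + \<gamma> *\<^sub>R mat 1"
    and nonneg: "\<And>i. i \<le> p \<Longrightarrow> 0 \<le> taylor_coeff p \<gamma> i t"
    and x: "G *v x \<le> b"
  shows "G *v (taylor_step A p t *v x) \<le> b"
proof -
  let ?M = "H + \<gamma> *\<^sub>R mat 1"
  let ?f = "\<lambda>i. taylor_coeff p \<gamma> i t"
  have "?M *v b = H *v b + \<gamma> *\<^sub>R b"
    by (simp add: matrix_vector_mult_add_rdistrib scaleR_matrix_vector_assoc[symmetric])
  with Hb have Mb: "?M *v b \<le> \<gamma> *\<^sub>R b" by (auto simp: less_eq_vec_def)
  have "matpow ?M i *v (G *v x) \<le> \<gamma> ^ i *\<^sub>R b" for i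
    using matpow_mult_vector_mono[OF M x] matpow_mult_vector_le[OF M Mb \<gamma>] by (rule order_trans)
  then have bound: "?f i *\<^sub>R (matpow ?M i *v (G *v x)) \<le> ?f i *\<^sub>R (\<gamma> ^ i *\<^sub>R b)" if "i \<le> p" for i
    using nonneg[OF that] by (intro scaleR_left_mono)
  have "G *v (taylor_step A p t *v x) = (\<Sum>i\<le>p. ?f i *\<^sub>R (matpow ?M i *v (G *v x)))"
    by (simp add: taylor_step_intertwine[OF HG] taylor_step_eq_sum_taylor_coeff[of H p t \<gamma>]
        sum_scaleR_mult_vector)
  also have "\<dots> \<le> (\<Sum>i\<le>p. ?f i *\<^sub>R (\<gamma> ^ i *\<^sub>R b))"
    using bound by (intro sum_mono) simp
  also have "\<dots> = (\<Sum>i\<le>p. ?f i * \<gamma> ^ i) *\<^sub>R b"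
    by (simp add: scaleR_sum_left)
  also have "\<dots> = b"
    by (simp add: sum_taylor_coeff_power)
  finally show ?thesis .
qed

lemma taylor_coeff_nonneg:
  assumes "i \<le> p" "0 \<le> t" "ereal t \<le> taylor_threshold p \<gamma>"
  shows "0 \<le> taylor_coeff p \<gamma> i t"
proof -
  have "taylor_threshold p \<gamma> \<le> first_pos_zero (taylor_coeff p \<gamma> i)"
    unfolding taylor_threshold_def using assms(1) by (intro Min_le) auto
  with assms have "ereal t \<le> first_pos_zero (poly (trunc_exp \<gamma> (p - i)))"
    by (simp add: first_pos_zero_taylor_coeff)
  then have "0 \<le> poly (trunc_exp \<gamma> (p - i)) t"
    using assms(2) by (intro poly_nonneg_before_first_pos_zero) (simp_all add: poly_trunc_exp_0)
  then show ?thesis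
    using assms(1,2) by (simp add: taylor_coeff_eq_trunc_exp)
qed

theorem corollary1:
  fixes A :: "real ^ 'n ^ 'n" and G :: "real ^ 'n ^ 'm" and b :: "real ^ 'm"
    and H :: "real ^ 'm ^ 'm" and \<gamma> :: real and p :: nat
  assumes "continuous_invariant A {x. G *v x \<le> b}"
    and "p \<ge> 1"
    and "offdiag_nonneg H" and "H ** G = G ** A" and "H *v b \<le> 0"
    and "\<gamma> > 0" and "0 \<le> H + \<gamma> *\<^sub>R mat 1"
  shows "steplength_threshold (taylor_step A p) {x. G *v x \<le> b} (taylor_threshold p \<gamma>) \<and>
    (\<exists>F :: real poly set. finite F \<and> F \<noteq> {} \<and> (\<forall>f\<in>F. unit_constant_form f) \<and>
       taylor_threshold p \<gamma> = Min ((\<lambda>f. first_pos_zero (poly f)) ` F))"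
proof -
  define F where "F = (\<lambda>i. trunc_exp \<gamma> (p - i)) ` {0..p}"
  have F: "finite F" "F \<noteq> {}"
    by (auto simp: F_def)
  have unit: "\<forall>f\<in>F. unit_constant_form f"
    using assms(6) by (auto simp: F_def unit_constant_form_trunc_exp)
  have threshold: "taylor_threshold p \<gamma> = Min ((\<lambda>f. first_pos_zero (poly f)) ` F)"
    unfolding taylor_threshold_def F_def image_image
    by (intro arg_cong[where f = Min] image_cong refl) (simp add: first_pos_zero_taylor_coeff)
  have "0 < taylor_threshold p \<gamma>"
    unfolding threshold using F
    by (auto simp: F_def intro!: first_pos_zero_poly_pos trunc_exp_nonzero)
  moreover have "discrete_invariant (taylor_step A p t) {x. G *v x \<le> b}"
    if "0 \<le> t" "ereal t \<le> taylor_threshold p \<gamma>" for t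
    unfolding discrete_invariant_def
    using taylor_step_preserves_polyhedron[OF assms(4,5) less_imp_le[OF assms(6)] assms(7)]
      taylor_coeff_nonneg that by auto
  ultimately show ?thesis
    unfolding steplength_threshold_def using F unit threshold by blast
qed

end
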